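(* Let $p$ be a prime and $d\ge3$ an integer. For any $a\in\mathbb{Q}^*$ and $b\in\mathcal{P}_0^+$, with $\psi_{d,a,b}(z)=\frac{z}{az^d+b}$ viewed as a map $\mathbb{P}^1\to\mathbb{P}^1$, \[\#\textup{PrePer}\bigl(\psi_{d,a,b},\mathbb{P}^1(\mathbb{Q})\bigr)\le 6.\]
   Context: $\mathcal{P}_0^+:=\{\sigma p^e:\sigma\in\{\pm1\},\ e\in\mathbb{Z},\ e\ge0\}$. In homogeneous coordinates $\psi_{d,a,b}([X,Y]) = [XY^{d-1}, aX^d+bY^d]$. $\textup{PrePer}(\phi,\mathbb{P}^1(\mathbb{Q}))$ is the set of points of $\mathbb{P}^1(\mathbb{Q})$ with finite forward orbit under $\phi$. *)

theory Defs
  imports Complex_Main "HOL-Computational_Algebra.Primes"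
begin

definition proj_rel :: "(('a::field \<times> 'a) \<times> ('a \<times> 'a)) set" where
  "proj_rel = {((x, y), (x', y')). (x, y) \<noteq> (0, 0) \<and> (\<exists>c. c \<noteq> 0 \<and> x' = c * x \<and> y' = c * y)}"

definition P1 :: "('a::field \<times> 'a) set set" where
  "P1 = (UNIV - {(0, 0)}) // proj_rel"

definition proj_pt :: "'a::field \<Rightarrow> 'a \<Rightarrow> ('a \<times> 'a) set" where
  "proj_pt x y = proj_rel `` {(x, y)}"

text \<open>The union ranges over all representatives of the point; the lemma \<open>psi_proj_pt\<close>
  shows that they all contribute the same class.\<close>

definition psi :: "nat \<Rightarrow> 'a::field \<Rightarrow> 'a \<Rightarrow> ('a \<times> 'a) set \<Rightarrow> ('a \<times> 'a) set" where
  "psi d a b P = (\<Union>(x, y)\<in>P. proj_pt (x * y ^ (d - 1)) (a * x ^ d + b * y ^ d))"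

definition PrePer :: "('b \<Rightarrow> 'b) \<Rightarrow> 'b set \<Rightarrow> 'b set" where
  "PrePer f S = {P \<in> S. finite {(f ^^ n) P | n. True}}"

definition signed_powers :: "nat \<Rightarrow> rat set" where
  "signed_powers p = {\<sigma> * of_nat p ^ e | \<sigma> e. \<sigma> \<in> {1, -1}}"

lemma equiv_proj_rel: "equiv (UNIV - {(0, 0)}) (proj_rel :: (('a::field \<times> 'a) \<times> ('a \<times> 'a)) set)"
  (is "equiv _ ?R")
proof (rule equivI)
  show "proj_rel \<subseteq> (UNIV - {(0, 0)}) \<times> (UNIV - {(0, 0)})"
    by (auto simp: proj_rel_def)
  show "refl_on (UNIV - {(0, 0)}) proj_rel"
    unfolding refl_on_def by (auto simp: proj_rel_def intro!: exI[of _ 1])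
  show "sym ?R"
  proof (rule symI)
    fix u v :: "'a \<times> 'a" assume "(u, v) \<in> proj_rel"
    then obtain c where "c \<noteq> 0" "u \<noteq> (0, 0)" "fst v = c * fst u" "snd v = c * snd u"
      by (auto simp: proj_rel_def)
    then show "(v, u) \<in> proj_rel"
      by (cases u; cases v) (auto simp: proj_rel_def intro!: exI[of _ "inverse c"])
  qed
  show "trans ?R"
  proof (rule transI)
    fix u v w :: "'a \<times> 'a" assume "(u, v) \<in> proj_rel" "(v, w) \<in> proj_rel"
    then obtain c c' where "c \<noteq> 0" "c' \<noteq> 0" "u \<noteq> (0, 0)" "fst v = c * fst u" "snd v = c * snd u"
      "fst w = c' * fst v" "snd w = c' * snd v"
      by (auto simp: proj_rel_def)
    then show "(u, w) \<in> proj_rel"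
      by (cases u; cases v; cases w) (auto simp: proj_rel_def intro!: exI[of _ "c' * c"])
  qed
qed

lemma proj_pt_in_P1: "(x, y) \<noteq> (0, 0) \<Longrightarrow> proj_pt x y \<in> P1"
  unfolding P1_def proj_pt_def by (rule quotientI) auto

lemma P1_cases:
  assumes "P \<in> P1"
  obtains x y where "(x, y) \<noteq> (0, 0)" "P = proj_pt x y"
  using assms unfolding P1_def proj_pt_def by (auto elim!: quotientE)

lemma proj_pt_scale:
  assumes "c \<noteq> 0" "(x, y) \<noteq> (0, 0)"
  shows "proj_pt (c * x) (c * y) = proj_pt x y"
proof -
  have "((x, y), (c * x, c * y)) \<in> proj_rel" using assms by (auto simp: proj_rel_def)
  then show ?thesis unfolding proj_pt_def
    using equiv_class_eq[OF equiv_proj_rel] by metis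
qed

lemma psi_nonzero:
  assumes "a \<noteq> 0" "b \<noteq> (0::'a::field)" "d \<ge> 2" "(x, y) \<noteq> (0, 0)"
  shows "(x * y ^ (d - 1), a * x ^ d + b * y ^ d) \<noteq> (0, 0)"
  using assms by (cases "x = 0"; cases "y = 0") (auto simp: power_0_left)

lemma psi_proj_pt:
  assumes "a \<noteq> 0" "b \<noteq> (0::'a::field)" "d \<ge> 2" "(x, y) \<noteq> (0, 0)"
  shows "psi d a b (proj_pt x y) = proj_pt (x * y ^ (d - 1)) (a * x ^ d + b * y ^ d)"
proof -
  have d: "c ^ d = c * c ^ (d - 1)" for c :: 'a
    using assms(3) by (cases d) auto
  have "proj_pt (u * v ^ (d - 1)) (a * u ^ d + b * v ^ d)
      = proj_pt (x * y ^ (d - 1)) (a * x ^ d + b * y ^ d)"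
    if uv: "(u, v) \<in> proj_pt x y" for u v
  proof -
    obtain c where c: "c \<noteq> 0" "u = c * x" "v = c * y"
      using uv by (auto simp: proj_pt_def proj_rel_def)
    have "u * v ^ (d - 1) = c ^ d * (x * y ^ (d - 1))"
      by (simp add: c d[of c] power_mult_distrib)
    moreover have "a * u ^ d + b * v ^ d = c ^ d * (a * x ^ d + b * y ^ d)"
      by (simp add: c power_mult_distrib algebra_simps)
    ultimately show ?thesis
      using proj_pt_scale[OF _ psi_nonzero[OF assms], of "c ^ d"] c(1) by simp
  qed
  moreover have "(x, y) \<in> proj_pt x y"
    using assms(4) by (auto simp: proj_pt_def proj_rel_def intro!: exI[of _ 1])
  ultimately show ?thesis
    unfolding psi_def by blast
qed

lemma psi_P1:
  assumes "a \<noteq> 0" "b \<noteq> (0::'a::field)" "d \<ge> 2" "P \<in> P1"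
  shows "psi d a b P \<in> P1"
  using assms(4)
proof (rule P1_cases)
  fix x y assume xy: "(x, y) \<noteq> (0, 0)" "P = proj_pt x y"
  show ?thesis
    unfolding xy(2) psi_proj_pt[OF assms(1-3) xy(1)]
    by (rule proj_pt_in_P1[OF psi_nonzero[OF assms(1-3) xy(1)]])
qed

lemma psi_affine:
  assumes "a \<noteq> 0" "b \<noteq> (0::'a::field)" "d \<ge> 2" "a * z ^ d + b \<noteq> 0"
  shows "psi d a b (proj_pt z 1) = proj_pt (z / (a * z ^ d + b)) 1"
  using psi_proj_pt[OF assms(1-3), of z 1] assms(4)
    proj_pt_scale[of "a * z ^ d + b" "z / (a * z ^ d + b)" 1]
  by simp

end

theory Submission
  imports Defs
begin

text \<open>
  Put \<open>t = a z\<^sup>d\<close> and \<open>u = t + b\<close>, so that one step of the map is \<open>z \<mapsto> z / u\<close> and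
  \<open>t \<mapsto> t / u\<^sup>d\<close>. Along a cycle avoiding \<open>0\<close>, valuations at the primes \<open>q \<noteq> p\<close> force every \<open>u\<close>
  to be a signed power of \<open>p\<close>. Consecutive values satisfy \<open>u\<^sup>d (u' - b) = u - b\<close>, and comparing
  \<open>p\<close>-adic valuations and absolute values leaves only \<open>u = 1\<close>, or \<open>u = -1\<close> with \<open>d\<close> even.
  A point \<open>z\<close> above a nonzero \<open>w\<close> is \<open>z = u w\<close> with \<open>u = b + (a w\<^sup>d) u\<^sup>d\<close>; bounding the rational
  roots \<open>u\<close> shows that the nonzero periodic points have only themselves above them, up to sign,
  and that nothing lies above the poles. Finally \<open>1 - b\<close> and \<open>-1 - b\<close> cannot both be \<open>a\<close> times a
  nonzero \<open>d\<close>-th power when \<open>d\<close> is even, because no two nonzero integral squares differ by a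
  divisor of \<open>2\<close>. So besides \<open>0\<close> and \<open>\<infinity>\<close> there are at most two fibres of \<open>z \<mapsto> a z\<^sup>d\<close>, each with
  at most two points.
\<close>

section \<open>Valuations on the rationals\<close>

text \<open>The \<open>q\<close>-adic valuation, with the junk value \<open>0\<close> at \<open>0\<close> in place of \<open>\<infinity>\<close>.\<close>

definition val :: "int \<Rightarrow> rat \<Rightarrow> int" where
  "val q x = int (multiplicity q (fst (quotient_of x))) - int (multiplicity q (snd (quotient_of x)))"

lemma rat_fraction:
  fixes x :: rat
  obtains m n where "x = of_int m / of_int n" "n > 0" "coprime m n"
  by (metis Rat_cases quotient_of_div quotient_of_denom_pos quotient_of_coprime surj_pair)

lemma multiplicity_mult_int:
  fixes q m n :: int
  assumes "prime q" "m \<noteq> 0" "n \<noteq> 0"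
  shows "multiplicity q (m * n) = multiplicity q m + multiplicity q n"
  using assms by (intro prime_elem_multiplicity_mult_distrib prime_imp_prime_elem)

text \<open>Cross-multiplication with the reduced fraction shows that any representation, not only
  lowest terms, computes the valuation.\<close>

lemma val_fraction:
  assumes "prime q" "m \<noteq> 0" "n \<noteq> 0"
  shows "val q (of_int m / of_int n) = int (multiplicity q m) - int (multiplicity q n)"
proof -
  obtain m' n' where q: "quotient_of (of_int m / of_int n) = (m', n')"
    by fastforce
  have n': "n' > 0" using q by (rule quotient_of_denom_pos)
  have eq: "(of_int m / of_int n :: rat) = of_int m' / of_int n'"
    using q by (rule quotient_of_div)
  then have "(of_int (m * n') :: rat) = of_int (m' * n)"
    using n' assms by (simp add: field_simps)
  then have eq': "m * n' = m' * n" by (simp only: of_int_eq_iff)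
  then have m': "m' \<noteq> 0" using n' assms by auto
  have "multiplicity q (m * n') = multiplicity q (m' * n)" by (simp add: eq')
  then have "multiplicity q m + multiplicity q n' = multiplicity q m' + multiplicity q n"
    using assms m' n' by (simp add: multiplicity_mult_int)
  then show ?thesis by (simp add: val_def q)
qed

lemma val_of_int:
  assumes "prime q" "m \<noteq> 0"
  shows "val q (of_int m) = int (multiplicity q m)"
  using val_fraction[OF assms, of 1] by simp

lemma val_one: "prime q \<Longrightarrow> val q 1 = 0"
  using val_of_int[of q 1] by simp

lemma val_mult:
  assumes "prime q" "x \<noteq> 0" "y \<noteq> 0"
  shows "val q (x * y) = val q x + val q y"
proof -
  obtain m n where x: "x = of_int m / of_int n" "n > 0" by (rule rat_fraction)
  obtain k l where y: "y = of_int k / of_int l" "l > 0" by (rule rat_fraction)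
  have nz: "m \<noteq> 0" "k \<noteq> 0" "n \<noteq> 0" "l \<noteq> 0" using x y assms by auto
  have "x * y = of_int (m * k) / of_int (n * l)" by (simp add: x y)
  then have "val q (x * y) = int (multiplicity q (m * k)) - int (multiplicity q (n * l))"
    using val_fraction[OF assms(1), of "m * k" "n * l"] nz by simp
  moreover have "val q x = int (multiplicity q m) - int (multiplicity q n)"
    unfolding x(1) using nz assms(1) by (intro val_fraction) auto
  moreover have "val q y = int (multiplicity q k) - int (multiplicity q l)"
    unfolding y(1) using nz assms(1) by (intro val_fraction) auto
  ultimately show ?thesis
    using nz assms(1) by (simp add: multiplicity_mult_int)
qed

lemma val_minus:
  assumes "prime q"
  shows "val q (- x) = val q x"
proof (cases "x = 0")
  case False
  have "val q (- 1) = 0" using val_of_int[OF assms, of "- 1"] assms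
    by (simp add: multiplicity_unit_right)
  then show ?thesis using val_mult[OF assms, of "- 1" x] False by simp
qed simp

lemma val_inverse:
  assumes "prime q" "x \<noteq> 0"
  shows "val q (inverse x) = - val q x"
  using val_mult[OF assms(1), of x "inverse x"] assms val_one by simp

lemma val_divide:
  assumes "prime q" "x \<noteq> 0" "y \<noteq> 0"
  shows "val q (x / y) = val q x - val q y"
  using val_mult[OF assms(1), of x "inverse y"] val_inverse[of q y] assms
  by (simp add: divide_inverse)

lemma val_power:
  assumes "prime q" "x \<noteq> 0"
  shows "val q (x ^ n) = int n * val q x"
  by (induction n) (use assms in \<open>simp_all add: val_one val_mult algebra_simps\<close>)

lemma val_power_int:
  assumes "prime q" "x \<noteq> 0"
  shows "val q (x powi k) = k * val q x"
proof (cases "k \<ge> 0")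
  case True
  then show ?thesis using val_power[OF assms] by (simp add: power_int_def)
next
  case False
  then show ?thesis
    using val_power[OF assms(1), of "inverse x" "nat (- k)"] val_inverse[OF assms] assms
    by (simp add: power_int_def)
qed

lemma val_add:
  assumes "prime q" "x \<noteq> 0" "y \<noteq> 0" "x + y \<noteq> 0"
  shows "min (val q x) (val q y) \<le> val q (x + y)"
proof -
  obtain m n where x: "x = of_int m / of_int n" "n > 0" by (rule rat_fraction)
  obtain k l where y: "y = of_int k / of_int l" "l > 0" by (rule rat_fraction)
  define X Y N where "X = m * l" and "Y = k * n" and "N = n * l"
  have eqs: "x = of_int X / of_int N" "y = of_int Y / of_int N"
    "x + y = of_int (X + Y) / of_int N"
    using x y by (auto simp: X_def Y_def N_def field_simps)
  have nz: "N \<noteq> 0" "X \<noteq> 0" "Y \<noteq> 0" "X + Y \<noteq> 0"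
    using eqs assms x(2) y(2) by (auto simp: N_def simp del: of_int_add)
  let ?r = "min (multiplicity q X) (multiplicity q Y)"
  have "q ^ ?r dvd X" "q ^ ?r dvd Y" by (auto intro!: multiplicity_dvd')
  then have "q ^ ?r dvd X + Y" by (rule dvd_add)
  then have "?r \<le> multiplicity q (X + Y)"
    using nz assms(1) by (intro multiplicity_geI) (auto dest: not_prime_unit)
  then show ?thesis
    using nz assms(1) unfolding eqs(3) by (simp add: eqs(1,2) val_fraction del: of_int_add)
qed

text \<open>The reverse bound is the ultrametric inequality for
  \<open>x = (x + y) + (- y)\<close>.\<close>

lemma val_add_eq:
  assumes "prime q" "x \<noteq> 0" "y \<noteq> 0" "val q x < val q y"
  shows "x + y \<noteq> 0" "val q (x + y) = val q x"
proof -
  show nz: "x + y \<noteq> 0"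
  proof
    assume "x + y = 0"
    then have "y = - x" by simp
    with assms val_minus[OF assms(1), of x] show False by simp
  qed
  have "min (val q (x + y)) (val q (- y)) \<le> val q (x + y + - y)"
    using assms nz by (intro val_add) auto
  moreover have "min (val q x) (val q y) \<le> val q (x + y)"
    using assms nz by (intro val_add) auto
  ultimately show "val q (x + y) = val q x"
    using assms val_minus[OF assms(1), of y] by auto
qed

text \<open>Needed where \<open>u = - b\<close>, since then \<open>u - b = 2 * u\<close> and the
  factor \<open>2\<close> may contribute when \<open>p = 2\<close>.\<close>

lemma val_two_le_one:
  assumes "prime q"
  shows "val q 2 \<le> 1"
proof -
  have "multiplicity q 2 \<le> 1"
  proof (rule ccontr)
    assume "\<not> ?thesis"
    then have "q ^ 2 dvd 2" by (intro multiplicity_dvd') auto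
    then have "q ^ 2 \<le> 2" by (rule zdvd_imp_le) simp
    moreover have "2 ^ 2 \<le> q ^ 2" using prime_ge_2_int[OF assms] by (intro power_mono) auto
    ultimately show False by simp
  qed
  then show ?thesis using val_of_int[OF assms, of 2] by simp
qed

text \<open>A prime dividing the reduced denominator would have negative valuation.\<close>

lemma integer_if_val_nonneg:
  assumes "x \<noteq> 0" "\<And>q. prime q \<Longrightarrow> val q x \<ge> 0"
  obtains n where "x = of_int n"
proof -
  obtain m n where x: "x = of_int m / of_int n" "n > 0" "coprime m n" by (rule rat_fraction)
  have m: "m \<noteq> 0" using x assms(1) by auto
  have "is_unit n"
  proof (rule ccontr)
    assume "\<not> is_unit n"
    then obtain q where q: "prime q" "q dvd n" using prime_divisor_exists[of n] x(2) by auto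
    have "\<not> q dvd m" using q x(3) by (meson coprime_common_divisor not_prime_unit)
    then have "multiplicity q m = 0" by (rule not_dvd_imp_multiplicity_0)
    moreover have "multiplicity q n > 0"
      using q x(2) by (metis multiplicity_eq_zero_iff not_prime_unit gr0I less_irrefl)
    ultimately have "val q x < 0" unfolding x(1) using q m x(2) by (simp add: val_fraction)
    then show False using assms(2)[OF q(1)] by simp
  qed
  then have "n = 1" using x(2) by (simp add: zdvd1_eq)
  then show ?thesis using that x(1) by simp
qed

text \<open>After division by the right power of \<open>p\<close> all valuations vanish, so the
  quotient and its inverse are both integers.\<close>

lemma signed_power_if_val_zero:
  assumes "prime p" "x \<noteq> 0" "\<And>q. prime q \<Longrightarrow> q \<noteq> p \<Longrightarrow> val q x = 0"
  shows "\<bar>x\<bar> = of_int p powi val p x"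
proof -
  have p0: "(of_int p :: rat) \<noteq> 0" using assms(1) by auto
  define y where "y = x / of_int p powi val p x"
  have y0: "y \<noteq> 0" using assms(2) p0 by (simp add: y_def)
  have vy: "val q y = 0" if q: "prime q" for q
  proof -
    have "val q y = val q x - val p x * val q (of_int p)"
      using q assms(2) p0 by (simp add: y_def val_divide val_power_int)
    moreover have "val q (of_int p) = (if q = p then 1 else 0)"
      using val_of_int[OF q, of p] q assms(1) p0
      by (auto simp: prime_multiplicity_other multiplicity_self)
    ultimately show ?thesis using assms(3)[OF q] by auto
  qed
  obtain m where m: "y = of_int m" using integer_if_val_nonneg[OF y0] vy by (metis order_refl)
  obtain n where n: "inverse y = of_int n"
    using integer_if_val_nonneg[of "inverse y"] vy y0 val_inverse
    by (metis neg_equal_0_iff_equal inverse_nonzero_iff_nonzero order_refl)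
  have "(of_int (m * n) :: rat) = 1" using m n y0 by (metis of_int_mult right_inverse)
  then have "m * n = 1" by (simp only: of_int_eq_1_iff)
  then have "\<bar>m\<bar> = 1" by (auto simp: zmult_eq_1_iff)
  then have "\<bar>y\<bar> = 1" using m by (metis of_int_1 of_int_abs)
  moreover have "x = y * of_int p powi val p x" using p0 by (simp add: y_def)
  moreover have "(of_int p powi val p x :: rat) > 0"
    using prime_gt_0_int[OF assms(1)] by simp
  ultimately show ?thesis by (metis abs_mult abs_of_pos mult_1)
qed

section \<open>Signed prime powers as coefficients, and \<open>p\<close>-units\<close>

text \<open>Only \<open>\<bar>b\<bar>\<close> is fixed, so the locale also applies to
  \<open>- b\<close>; the points sent to their negatives are handled that way.\<close>

locale prime_power_coeff =
  fixes p :: int and e d :: nat and b :: rat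
  assumes prime_p: "prime p" and abs_b: "\<bar>b\<bar> = of_int p ^ e" and d3: "d \<ge> 3"
begin

text \<open>The unit group of Z[1/p]: signed powers of \<open>p\<close>, with negative exponents
  allowed.\<close>

definition p_unit :: "rat \<Rightarrow> bool" where
  "p_unit x \<longleftrightarrow> x \<noteq> 0 \<and> (\<forall>q. prime q \<longrightarrow> q \<noteq> p \<longrightarrow> val q x = 0)"

lemma p_ge_2: "(of_int p :: rat) \<ge> 2"
  using prime_ge_2_int[OF prime_p] by (metis of_int_le_iff of_int_numeral)

lemma b_nonzero: "b \<noteq> 0"
  using abs_b p_ge_2 by auto

lemma abs_b_ge_1: "\<bar>b\<bar> \<ge> 1"
  unfolding abs_b using p_ge_2 by (intro one_le_power) simp

lemma val_b: "prime q \<Longrightarrow> val q b = (if q = p then int e else 0)"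
proof -
  assume q: "prime q"
  have p0: "p \<noteq> 0" using prime_p by auto
  have "val q b = val q \<bar>b\<bar>" using val_minus[OF q] by (simp add: abs_if)
  also have "\<dots> = int e * val q (of_int p)"
    unfolding abs_b using q p0 by (intro val_power) auto
  also have "val q (of_int p) = (if q = p then 1 else 0)"
    using val_of_int[OF q p0] q prime_p
    by (auto simp: prime_multiplicity_other multiplicity_self)
  finally show ?thesis by auto
qed

lemma b_integer: obtains B where "b = of_int B" "\<bar>B\<bar> = p ^ e"
proof -
  have "b = of_int (p ^ e) \<or> b = of_int (- (p ^ e))"
    using abs_b by (simp add: abs_if split: if_splits)
  moreover have "p ^ e \<ge> 0" using prime_gt_0_int[OF prime_p] by simp
  ultimately show ?thesis using that by (metis abs_minus_cancel abs_of_nonneg)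
qed

lemma p_unit_b: "p_unit b"
  using b_nonzero val_b by (auto simp: p_unit_def)

lemma p_unit_mult: "p_unit x \<Longrightarrow> p_unit y \<Longrightarrow> p_unit (x * y)"
  by (auto simp: p_unit_def val_mult)

lemma p_unit_power: "p_unit x \<Longrightarrow> p_unit (x ^ n)"
  by (auto simp: p_unit_def val_power)

lemma abs_p_unit: "p_unit x \<Longrightarrow> \<bar>x\<bar> = of_int p powi val p x"
  unfolding p_unit_def using signed_power_if_val_zero[OF prime_p] by blast

lemma p_unit_abs_eq_1: "p_unit x \<Longrightarrow> val p x = 0 \<Longrightarrow> \<bar>x\<bar> = 1"
  using abs_p_unit by simp

lemma p_unit_abs_ge_2:
  assumes "p_unit x" "val p x > 0"
  shows "\<bar>x\<bar> \<ge> 2"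
proof -
  have "\<bar>x\<bar> = of_int p ^ nat (val p x)"
    using abs_p_unit[OF assms(1)] assms(2) by (simp add: power_int_def)
  also have "\<dots> \<ge> of_int p ^ 1"
    using p_ge_2 assms(2) by (intro power_increasing) auto
  finally show ?thesis using p_ge_2 by simp
qed

lemma p_unit_abs_le_half:
  assumes "p_unit x" "val p x < 0"
  shows "\<bar>x\<bar> \<le> 1 / 2"
proof -
  have x0: "x \<noteq> 0" using assms by (simp add: p_unit_def)
  have "p_unit (inverse x)" "val p (inverse x) > 0"
    using assms x0 prime_p by (auto simp: p_unit_def val_inverse)
  from p_unit_abs_ge_2[OF this] show ?thesis using x0 by (simp add: field_simps)
qed

lemma abs_eq_if_val_eq:
  assumes "p_unit x" "p_unit y" "val p x = val p y"
  shows "x = y \<or> x = - y"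
  using abs_p_unit[OF assms(1)] abs_p_unit[OF assms(2)] assms(3)
  by (metis abs_eq_iff)

lemma val_diff_b:
  assumes "prime q" "x \<noteq> 0"
  shows "val q x < val q b \<Longrightarrow> val q (x - b) = val q x"
    and "val q b < val q x \<Longrightarrow> val q (x - b) = val q b"
    and "x \<noteq> b \<Longrightarrow> min (val q x) (val q b) \<le> val q (x - b)"
  using val_add_eq(2)[OF assms(1), of x "- b"] val_add_eq(2)[OF assms(1), of "- b" x]
    val_add[OF assms(1), of x "- b"] assms b_nonzero val_minus[OF assms(1)] by auto

lemma d_mult_ge: "k > 0 \<Longrightarrow> int d * k \<ge> 3 * k"
  using d3 by (intro mult_right_mono) auto

lemma d_mult_le: "k < 0 \<Longrightarrow> int d * k \<le> 3 * k"
  using d_mult_ge[of "- k"] by auto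

section \<open>Backward steps: rational solutions of the preimage equations\<close>

text \<open>If \<open>a * w ^ d = - b\<close> and \<open>u * w\<close> maps to \<open>w\<close>,
  then \<open>u\<close> satisfies this equation. Primes other than \<open>p\<close> force
  \<open>u\<close> to be a \<open>p\<close>-unit; then each sign of \<open>val p u\<close> is
  refuted separately.\<close>

lemma no_preimage_of_pole:
  assumes eq: "b * u ^ d + u = b"
  shows False
proof -
  have u0: "u \<noteq> 0" using eq b_nonzero d3 by (auto simp: power_0_left)
  have bud0: "b * u ^ d \<noteq> 0" using u0 b_nonzero by simp
  have val_bud: "val q (b * u ^ d) = val q b + int d * val q u" if "prime q" for q
    using that u0 b_nonzero by (simp add: val_mult val_power)
  have pu: "p_unit u"
    unfolding p_unit_def
  proof (intro conjI allI impI u0)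
    fix q assume q: "prime q" "q \<noteq> p"
    have vb: "val q b = 0" using val_b q by simp
    have "\<not> val q u < 0"
    proof
      assume neg: "val q u < 0"
      then have "val q (b * u ^ d) < val q u" using val_bud[OF q(1)] vb d_mult_le by fastforce
      then have "val q (b * u ^ d + u) = val q (b * u ^ d)"
        using q u0 bud0 by (intro val_add_eq) auto
      then show False using eq vb neg \<open>val q (b * u ^ d) < val q u\<close> by simp
    qed
    moreover have "\<not> val q u > 0"
    proof
      assume pos: "val q u > 0"
      have "min (val q (b * u ^ d)) (val q u) \<le> val q (b * u ^ d + u)"
        using q u0 bud0 eq b_nonzero by (intro val_add) auto
      then show False using eq vb pos val_bud[OF q(1)] d_mult_ge[OF pos] by auto
    qed
    ultimately show "val q u = 0" by simp
  qed
  let ?k = "val p u"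
  have vb: "val p b = int e" using val_b prime_p by simp
  have vbud: "val p (b * u ^ d) = int e + int d * ?k" using val_bud[OF prime_p] vb by simp
  consider "?k > 0" | "?k < 0" | "?k = 0" by linarith
  then show False
  proof cases
    case 1
    then have "val p u < val p (b * u ^ d)" using vbud d_mult_ge[OF 1] by linarith
    then have "val p (u + b * u ^ d) = val p u"
      using prime_p u0 bud0 by (intro val_add_eq) auto
    then have "val p u = val p b" using eq by (simp add: add.commute)
    then consider "u = b" | "u = - b" using abs_eq_if_val_eq pu p_unit_b by blast
    then show False
    proof cases
      case 1
      then show False using eq bud0 by simp
    next
      case 2
      then have "b * (u ^ d - 2) = 0" using eq by (simp add: algebra_simps)
      then have "u ^ d = 2" using b_nonzero by simp
      then have "int d * ?k = val p 2" using val_power[OF prime_p u0, of d] by simp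
      then show False using val_two_le_one[OF prime_p] d_mult_ge[OF \<open>?k > 0\<close>] \<open>?k > 0\<close> by simp
    qed
  next
    case 2
    have veq: "val p (b * u ^ d) = val p u"
    proof (rule ccontr)
      assume ne: "val p (b * u ^ d) \<noteq> val p u"
      then have "val p (b * u ^ d + u) \<le> ?k"
        using val_add_eq(2)[OF prime_p bud0 u0] val_add_eq(2)[OF prime_p u0 bud0]
        by (cases "val p (b * u ^ d) < val p u") (auto simp: add.commute)
      then show False using eq vb 2 by simp
    qed
    then have "b * u ^ d = u \<or> b * u ^ d = - u"
      by (intro abs_eq_if_val_eq pu p_unit_mult p_unit_b p_unit_power)
    then have "\<bar>b\<bar> = 2 * \<bar>u\<bar>" using eq b_nonzero by auto
    \<comment> \<open>The equal valuations say \<open>e = (1 - d) * val p u\<close>, which is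
      positive.\<close>
    moreover have "\<bar>b\<bar> \<ge> 2"
    proof (rule p_unit_abs_ge_2[OF p_unit_b])
      show "val p b > 0" using veq vbud vb d_mult_le[OF 2] 2 by linarith
    qed
    ultimately show False using p_unit_abs_le_half[OF pu 2] by simp
  next
    case 3
    then have "u = 1 \<or> u = - 1" using p_unit_abs_eq_1[OF pu] by (auto simp: abs_if split: if_splits)
    then show False using eq abs_b_ge_1 by (cases "even d") (auto simp: abs_if split: if_splits)
  qed
qed

text \<open>If \<open>a * w ^ d = 1 - b\<close> and \<open>u * w\<close> maps to \<open>w\<close>,
  then \<open>u\<close> satisfies this equation. No prime other than \<open>p\<close> divides the
  numerator of \<open>u\<close>, so either \<open>1 / u\<close> or \<open>b / u\<close> is an
  integer, and size estimates finish both cases.\<close>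

lemma fixed_point_only_preimage:
  assumes eq: "u = b + (1 - b) * u ^ d"
  shows "u = 1"
proof (cases "b = 1")
  case True
  then show ?thesis using eq by simp
next
  case False
  obtain B where B: "b = of_int B" "\<bar>B\<bar> = p ^ e" by (rule b_integer)
  have B1: "\<bar>B\<bar> \<ge> 1" using abs_b_ge_1 B(1) by auto
  have u0: "u \<noteq> 0" using eq b_nonzero d3 by (auto simp: power_0_left)
  have eq': "u - b = (1 - b) * u ^ d" using eq by (simp add: algebra_simps)
  have c0: "1 - b \<noteq> 0" using False by simp
  have val_c: "val q (1 - b) \<ge> 0" if "prime q" for q
    using val_of_int[OF that, of "1 - B"] c0 B(1) by auto
  have val_diff: "val q (u - b) = val q (1 - b) + int d * val q u" if "prime q" for q
    unfolding eq' using that c0 u0 by (simp add: val_mult val_power)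
  obtain r where r: "d = Suc r" "r \<ge> 2" using d3 by (cases d) auto
  have val_other: "val q u \<le> 0" if q: "prime q" "q \<noteq> p" for q
    using val_diff_b(2)[OF q(1) u0] val_diff[OF q(1)] val_c[OF q(1)] val_b[OF q(1)] q(2)
      d_mult_ge[of "val q u"] by fastforce
  have vb: "val p b = int e" using val_b prime_p by simp
  show ?thesis
  proof (cases "val p u \<le> 0")
    case True
    then have "val q (inverse u) \<ge> 0" if "prime q" for q
      using val_other[OF that] val_inverse[OF that u0] by (cases "q = p") auto
    then obtain y where y: "inverse u = of_int y"
      using integer_if_val_nonneg[of "inverse u"] u0 by auto
    have y0: "y \<noteq> 0" using y u0 by auto
    have uy: "u = 1 / of_int y" using y by (metis inverse_eq_divide inverse_inverse_eq)
    have "of_int (y ^ r * (1 - B * y)) = (of_int (1 - B) :: rat)"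
      using eq y0 unfolding uy r(1) B(1) by (simp add: field_simps)
    then have yeq: "y ^ r * (1 - B * y) = 1 - B" by (simp only: of_int_eq_iff)
    have "\<not> \<bar>y\<bar> \<ge> 2"
    proof
      assume y2: "\<bar>y\<bar> \<ge> 2"
      have "2 ^ 2 \<le> \<bar>y\<bar> ^ 2" using y2 by (intro power_mono) auto
      also have "\<dots> \<le> \<bar>y\<bar> ^ r" using y2 r(2) by (intro power_increasing) auto
      finally have yr: "\<bar>y\<bar> ^ r \<ge> 4" by simp
      have "\<bar>B\<bar> * \<bar>y\<bar> \<ge> \<bar>B\<bar> * 2" using y2 by (intro mult_left_mono) auto
      then have "\<bar>1 - B * y\<bar> \<ge> 2 * \<bar>B\<bar> - 1"
        using abs_mult[of B y] by linarith
      \<comment> \<open>With the upper bound \<open>1 + \<bar>B\<bar>\<close> this would give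
        \<open>7 * \<bar>B\<bar> \<le> 5\<close>.\<close>
      then have "4 * (2 * \<bar>B\<bar> - 1) \<le> \<bar>y\<bar> ^ r * \<bar>1 - B * y\<bar>"
        using yr B1 by (intro mult_mono) auto
      also have "\<dots> = \<bar>1 - B\<bar>" using yeq by (metis abs_mult power_abs)
      also have "\<dots> \<le> 1 + \<bar>B\<bar>" by linarith
      finally show False using B1 by (simp add: algebra_simps)
    qed
    then have "y = 1 \<or> y = - 1" using y0 by linarith
    then show ?thesis
      using uy yeq B1 by (cases "even r") auto
  next
    case False
    \<comment> \<open>Otherwise \<open>u - b\<close> has valuation at most \<open>val p u\<close>,
      whereas the equation makes it at least \<open>d * val p u\<close>.\<close>
    have ke: "val p u = val p b"
    proof (rule ccontr)
      assume "val p u \<noteq> val p b"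
      then have "val p (u - b) \<le> val p u"
        using val_diff_b(1,2)[OF prime_p u0] by linarith
      then show False using val_diff[OF prime_p] val_c[OF prime_p] False d_mult_ge[of "val p u"]
        by linarith
    qed
    have "val q (b / u) \<ge> 0" if "prime q" for q
      using val_other[OF that] val_divide[OF that b_nonzero u0] ke val_b[OF that]
      by (cases "q = p") auto
    then obtain n where n: "b / u = of_int n"
      using integer_if_val_nonneg[of "b / u"] u0 b_nonzero by auto
    have n0: "n \<noteq> 0" using n u0 b_nonzero by auto
    have un: "u = of_int B / of_int n" using n u0 n0 B(1) by (simp add: field_simps)
    have B0: "B \<noteq> 0" using B1 by auto
    have "of_int B * of_int (n ^ r * (1 - n)) = (of_int B * of_int ((1 - B) * B ^ r) :: rat)"
      using eq n0 unfolding un r(1) B(1) by (simp add: field_simps)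
    then have "(of_int (n ^ r * (1 - n)) :: rat) = of_int ((1 - B) * B ^ r)"
      using B0 by (metis mult_cancel_left of_int_eq_0_iff)
    then have neq: "n ^ r * (1 - n) = (1 - B) * B ^ r" by (simp only: of_int_eq_iff)
    have "val p (of_int n) = 0"
      using val_divide[OF prime_p b_nonzero u0] ke n by simp
    then have "multiplicity p n = 0" using val_of_int[OF prime_p n0] by simp
    then have "\<not> p dvd n" using n0 prime_p by (metis multiplicity_eq_zero_iff not_prime_unit)
    then have "coprime (p ^ e) n" using prime_p prime_imp_coprime coprime_power_left_iff by blast
    then have "coprime B n" using B(2) by (metis coprime_abs_left_iff)
    then have cop: "coprime (B ^ r) (n ^ r)" by simp
    \<comment> \<open>Cancelling \<open>B ^ r\<close> leaves \<open>n ^ r * s = 1 - B\<close> with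
      \<open>s\<close> nonzero. Then \<open>1 - n = B ^ r * s\<close> makes \<open>n\<close> large,
      too large for the right-hand side.\<close>
    have "B ^ r dvd n ^ r * (1 - n)" using neq by simp
    then have "B ^ r dvd 1 - n" using cop coprime_dvd_mult_right_iff by blast
    then obtain s where s: "1 - n = B ^ r * s" by blast
    then have ns: "n ^ r * s = 1 - B" using neq B0 by auto
    have "s \<noteq> 0" using ns B(1) c0 by auto
    then have s1: "1 \<le> \<bar>s\<bar>" by linarith
    have B2: "\<bar>B\<bar> \<ge> 2"
      using p_unit_abs_ge_2[OF p_unit_b] ke False B(1) by auto
    have "2 * \<bar>B\<bar> \<le> \<bar>B\<bar> ^ 2" unfolding power2_eq_square using B2 by (intro mult_right_mono) auto
    also have "\<dots> \<le> \<bar>B\<bar> ^ r" using B2 r(2) by (intro power_increasing) auto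
    also have "\<dots> \<le> \<bar>B\<bar> ^ r * \<bar>s\<bar>" using mult_left_mono[OF s1, of "\<bar>B\<bar> ^ r"] by simp
    also have "\<dots> = \<bar>1 - n\<bar>" by (simp add: s abs_mult power_abs)
    finally have n3: "\<bar>n\<bar> \<ge> 2 * \<bar>B\<bar> - 1" by linarith
    have "3 * \<bar>n\<bar> \<le> \<bar>n\<bar> ^ 2" unfolding power2_eq_square using n3 B2 by (intro mult_right_mono) auto
    also have "\<dots> \<le> \<bar>n\<bar> ^ r" using n3 B2 r(2) by (intro power_increasing) auto
    also have "\<dots> \<le> \<bar>n\<bar> ^ r * \<bar>s\<bar>" using mult_left_mono[OF s1, of "\<bar>n\<bar> ^ r"] by simp
    also have "\<dots> = \<bar>1 - B\<bar>" by (simp add: ns[symmetric] abs_mult power_abs)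
    finally show ?thesis using n3 B2 by linarith
  qed
qed

section \<open>Forward steps: consecutive values of \<open>u\<close> on a cycle\<close>

lemma val_diff_step:
  assumes "prime q" "u \<noteq> 0" "u' \<noteq> b" "u ^ d * (u' - b) = u - b"
  shows "val q (u' - b) = val q (u - b) - int d * val q u"
proof -
  have "val q (u - b) = val q (u ^ d * (u' - b))" by (simp only: assms(4))
  also have "\<dots> = int d * val q u + val q (u' - b)"
    using assms(1-3) by (simp add: val_mult val_power)
  finally show ?thesis by simp
qed

text \<open>Dividing by \<open>u ^ d\<close> makes the valuation of \<open>u' - b\<close> negative,
  so \<open>\<bar>u'\<bar> \<le> 1 / 2\<close>. Then \<open>u' - b\<close> is not small, and
  \<open>u ^ d * (u' - b)\<close> is too large to equal \<open>u - b\<close>.\<close>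

lemma no_step_from_val_pos:
  assumes u: "p_unit u" "u \<noteq> b" and u': "p_unit u'" "u' \<noteq> b"
    and step: "u ^ d * (u' - b) = u - b" and pos: "val p u > 0"
  shows False
proof -
  have u0: "u \<noteq> 0" "u' \<noteq> 0" using u u' by (auto simp: p_unit_def)
  have vb: "val p b = int e" using val_b prime_p by simp
  \<comment> \<open>The extra \<open>1\<close> covers \<open>u = - b\<close> with
    \<open>p = 2\<close>.\<close>
  have le: "val p (u - b) \<le> val p u + 1"
  proof (cases "val p u = val p b")
    case True
    then have "u = - b" using abs_eq_if_val_eq u p_unit_b by blast
    then have "val p (u - b) = val p (2 * u)" by simp
    then show ?thesis
      using val_mult[OF prime_p, of 2 u] val_two_le_one[OF prime_p] u0 by simp
  next
    case False
    then show ?thesis using val_diff_b(1,2)[OF prime_p u0(1)] by linarith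
  qed
  have "val p (u' - b) < 0"
    using val_diff_step[OF prime_p u0(1) u'(2) step] le d_mult_ge[OF pos] pos by linarith
  then have "val p u' < 0" using val_diff_b(3)[OF prime_p u0(2) u'(2)] vb by linarith
  then have small: "\<bar>u'\<bar> \<le> 1 / 2" by (rule p_unit_abs_le_half[OF u'(1)])
  have u2: "\<bar>u\<bar> \<ge> 2" by (rule p_unit_abs_ge_2[OF u(1) pos])
  have "4 * \<bar>u\<bar> \<le> \<bar>u\<bar> ^ 2 * \<bar>u\<bar>"
    using u2 power_mono[of 2 "\<bar>u\<bar>" 2] by (intro mult_right_mono) auto
  also have "\<dots> = \<bar>u\<bar> ^ 3" by (simp add: eval_nat_numeral)
  also have "\<dots> \<le> \<bar>u\<bar> ^ d" using u2 d3 by (intro power_increasing) auto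
  finally have "4 * \<bar>u\<bar> * (\<bar>b\<bar> - 1 / 2) \<le> \<bar>u\<bar> ^ d * \<bar>u' - b\<bar>"
    using small abs_b_ge_1 by (intro mult_mono) auto
  also have "\<dots> = \<bar>u - b\<bar>" using step by (metis abs_mult power_abs)
  also have "\<dots> \<le> \<bar>u\<bar> + \<bar>b\<bar>" by linarith
  finally have "(4 * \<bar>b\<bar> - 3) * \<bar>u\<bar> \<le> \<bar>b\<bar>" by (simp add: algebra_simps)
  moreover have "(4 * \<bar>b\<bar> - 3) * 2 \<le> (4 * \<bar>b\<bar> - 3) * \<bar>u\<bar>"
    using u2 abs_b_ge_1 by (intro mult_left_mono) auto
  ultimately have "(4 * \<bar>b\<bar> - 3) * 2 \<le> \<bar>b\<bar>" by (rule order.trans[rotated])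
  then show False using abs_b_ge_1 by (simp add: algebra_simps)
qed

text \<open>The first step makes \<open>u' - b\<close> divisible by \<open>p\<close> at least twice.
  The second step rules out \<open>val p u' > 0\<close>, which leaves only \<open>u' = - b\<close>
  with \<open>\<bar>b\<bar> = 1\<close>, where \<open>u' - b = 2 * u'\<close> has valuation at most
  \<open>1\<close>.\<close>

lemma no_two_steps_from_val_neg:
  assumes u: "p_unit u" and u': "p_unit u'" "u' \<noteq> b" and u'': "p_unit u''" "u'' \<noteq> b"
    and step: "u ^ d * (u' - b) = u - b" and step': "u' ^ d * (u'' - b) = u' - b"
    and neg: "val p u < 0"
  shows False
proof -
  have u0: "u \<noteq> 0" "u' \<noteq> 0" using u u' by (auto simp: p_unit_def)
  have vb: "val p b = int e" using val_b prime_p by simp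
  have "val p (u - b) = val p u" using val_diff_b(1)[OF prime_p u0(1)] neg vb by simp
  then have ge: "val p (u' - b) \<ge> 2"
    using val_diff_step[OF prime_p u0(1) u'(2) step] d_mult_le[OF neg] neg by linarith
  have "\<not> val p u' > 0" using no_step_from_val_pos[OF u' u'' step'] by blast
  moreover have "\<not> val p u' < val p b" using val_diff_b(1)[OF prime_p u0(2)] ge calculation by linarith
  ultimately have "val p u' = val p b" "val p b = 0" using vb by auto
  then have "u' = - b" using abs_eq_if_val_eq u' p_unit_b by blast
  then have "val p (u' - b) = val p (2 * u')" by simp
  then show False
    using val_mult[OF prime_p, of 2 u'] val_two_le_one[OF prime_p] u0 ge
      \<open>val p u' = val p b\<close> \<open>val p b = 0\<close> by simp
qed

text \<open>Valuations off \<open>p\<close> make every \<open>u n\<close> a \<open>p\<close>-unit;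
  the two preceding lemmas then remove the power of \<open>p\<close>, leaving \<open>1\<close> or
  \<open>- 1\<close>.\<close>

lemma periodic_orbit_multiplier:
  fixes z :: "nat \<Rightarrow> rat"
  assumes a: "a \<noteq> 0" and z0: "\<And>n. z n \<noteq> 0" and w0: "\<And>n. a * z n ^ d + b \<noteq> 0"
    and step: "\<And>n. z (Suc n) = z n / (a * z n ^ d + b)"
    and k: "k > 0" and per: "\<And>n. z (n + k) = z n"
  shows "a * z 0 ^ d = 1 - b \<or> even d \<and> a * z 0 ^ d = - 1 - b"
proof -
  define t u where "t n = a * z n ^ d" and "u n = a * z n ^ d + b" for n
  have t0: "t n \<noteq> 0" for n using a z0 by (simp add: t_def)
  have u0: "u n \<noteq> 0" for n using w0 by (simp add: u_def)
  have ut: "u n = t n + b" for n by (simp add: t_def u_def)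
  have ub: "u n \<noteq> b" for n using t0 by (simp add: ut)
  have tS: "t (Suc n) = t n / u n ^ d" for n
    by (simp add: t_def u_def step power_divide)
  have ustep: "u n ^ d * (u (Suc n) - b) = u n - b" for n
    using u0 tS[of n] by (simp add: ut)
  \<comment> \<open>At a prime \<open>q \<noteq> p\<close> positive valuation of \<open>t\<close> persists forever and negative valuation turns
    positive after one step, so on a cycle the valuation of \<open>t\<close> is nonnegative.\<close>
  have pu: "p_unit (u n)" for n
    unfolding p_unit_def
  proof (intro conjI allI impI u0)
    fix q assume q: "prime q" "q \<noteq> p"
    have vb: "val q b = 0" using val_b q by simp
    have tauS: "val q (t (Suc m)) = val q (t m) - int d * val q (u m)" for m
      unfolding tS using q t0 u0 by (simp add: val_divide val_power)
    have u_pos: "val q (u m) = 0" if "val q (t m) > 0" for m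
      using val_add_eq(2)[OF q(1) b_nonzero t0[of m]] that vb by (simp add: ut add.commute)
    have u_neg: "val q (u m) = val q (t m)" if "val q (t m) < 0" for m
      using val_add_eq(2)[OF q(1) t0[of m] b_nonzero] that vb by (simp add: ut)
    have pos: "val q (t (m + i)) > 0" if "val q (t m) > 0" for m i
      by (induction i) (use that tauS u_pos in auto)
    have nonneg: "val q (t m) \<ge> 0" for m
    proof (rule ccontr)
      assume "\<not> ?thesis"
      then have neg: "val q (t m) < 0" by simp
      have "val q (t (Suc m)) > 0"
        using tauS[of m] d_mult_le[OF neg] neg unfolding u_neg[OF neg] by linarith
      \<comment> \<open>Positivity starts at \<open>Suc m\<close>, so \<open>k - 1\<close> further
        steps complete the period.\<close>
      from pos[OF this, of "k - 1"] have "val q (t (m + k)) > 0" using k by simp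
      then show False using neg per by (simp add: t_def)
    qed
    show "val q (u n) = 0"
    proof (cases "val q (t n) > 0")
      case False
      then have tau: "val q (t n) = 0" using nonneg[of n] by simp
      have "val q (u n) \<ge> 0"
        using val_add[OF q(1) t0 b_nonzero, of n] u0[of n] tau vb by (simp add: ut)
      \<comment> \<open>Otherwise the next \<open>t\<close> would have negative valuation.\<close>
      moreover have "\<not> val q (u n) > 0"
        using tauS[of n] nonneg[of "Suc n"] tau d_mult_ge[of "val q (u n)"] by linarith
      ultimately show ?thesis by simp
    qed (rule u_pos)
  qed
  have "val p (u n) = 0" for n
    using no_step_from_val_pos[OF pu ub pu ub ustep, of n]
      no_two_steps_from_val_neg[OF pu pu ub pu ub ustep ustep, of n] by fastforce
  then have u1: "u n = 1 \<or> u n = - 1" for n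
    using p_unit_abs_eq_1[OF pu, of n] by (auto simp: abs_if split: if_splits)
  show ?thesis
  proof (cases "u 0 = 1")
    case True
    then show ?thesis by (simp add: u_def)
  next
    case False
    then have m1: "u 0 = - 1" using u1 by blast
    have "even d"
    proof (rule ccontr)
      assume "odd d"
      \<comment> \<open>Since \<open>u 1\<close> is \<open>1\<close> or \<open>- 1\<close>, this
        forces \<open>b = 0\<close> or \<open>b = - 1 = u 0\<close>, both excluded.\<close>
      then have "u 1 = 1 + 2 * b" using ustep[of 0] m1 by (simp add: algebra_simps)
      then show False using u1[of 1] b_nonzero ub[of 0] m1 by auto
    qed
    then show ?thesis using m1 by (simp add: u_def)
  qed
qed

end

section \<open>Affine coordinates and fibres of the power map\<close>

lemma proj_pt_affine_eq_iff: "proj_pt x 1 = proj_pt y 1 \<longleftrightarrow> x = y"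
proof
  assume eq: "proj_pt x 1 = proj_pt y 1"
  have "(y, 1) \<in> proj_pt y 1" by (auto simp: proj_pt_def proj_rel_def)
  with eq have "(y, 1) \<in> proj_pt x 1" by simp
  then show "x = y" by (auto simp: proj_pt_def proj_rel_def)
qed simp

lemma proj_pt_affine_neq_infinity: "proj_pt x 1 \<noteq> proj_pt 1 0"
proof
  assume eq: "proj_pt x 1 = proj_pt 1 0"
  have "(x, 1) \<in> proj_pt x 1" by (auto simp: proj_pt_def proj_rel_def)
  with eq have "(x, 1) \<in> proj_pt 1 0" by simp
  then show False by (auto simp: proj_pt_def proj_rel_def)
qed

lemma P1_affine_cases:
  assumes "P \<in> P1"
  obtains "P = proj_pt 1 0" | z where "P = proj_pt z 1"
proof -
  obtain x y where xy: "(x, y) \<noteq> (0, 0)" "P = proj_pt x y" using assms by (rule P1_cases)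
  show thesis
  proof (cases "y = 0")
    case True
    then show thesis using that(1) xy proj_pt_scale[of x 1 0] by simp
  next
    case False
    then show thesis using that(2) xy proj_pt_scale[of y "x / y" 1] by simp
  qed
qed

lemma card_power_fibre:
  fixes a c :: rat
  assumes "a \<noteq> 0" "d > 0"
  shows "finite {z. z \<noteq> 0 \<and> a * z ^ d = c} \<and> card {z. z \<noteq> 0 \<and> a * z ^ d = c} \<le> 2"
    (is "finite ?T \<and> card ?T \<le> 2")
proof (cases "?T = {}")
  case True
  show ?thesis unfolding True by simp
next
  case False
  then obtain w where w: "a * w ^ d = c" by blast
  have "?T \<subseteq> {w, - w}"
  proof
    fix z assume "z \<in> ?T"
    then have "a * z ^ d = a * w ^ d" using w by simp
    then have "z ^ d = w ^ d" using assms(1) by simp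
    then have "\<bar>z\<bar> ^ d = \<bar>w\<bar> ^ d" by (metis power_abs)
    then have "\<bar>z\<bar> = \<bar>w\<bar>" by (rule power_eq_imp_eq_base) (use assms(2) in auto)
    then show "z \<in> {w, - w}" by (auto simp: abs_eq_iff)
  qed
  then have "finite ?T" "card ?T \<le> card {w, - w}" by (auto intro: finite_subset card_mono)
  moreover have "card {w, - w} \<le> 2" by (simp add: card_insert_if)
  ultimately show ?thesis by simp
qed

text \<open>The ratio of the two right-hand sides would be a rational square. In lowest terms this
  gives \<open>1 - B = m ^ 2 * c\<close> and \<open>- 1 - B = n ^ 2 * c\<close>, hence
  \<open>c * (m ^ 2 - n ^ 2) = 2\<close>.\<close>

lemma no_even_power_ratio:
  fixes a z w :: rat and B :: int
  assumes "even d" "z \<noteq> 0" "w \<noteq> 0" "a \<noteq> 0"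
    and z: "a * z ^ d = 1 - of_int B" and w: "a * w ^ d = - 1 - of_int B"
  shows False
proof -
  obtain i where d: "d = i * 2" using assms(1) by (auto elim: evenE simp: mult.commute)
  obtain m n where mn: "(z / w) ^ i = of_int m / of_int n" "n > 0" "coprime m n"
    by (rule rat_fraction)
  have m0: "m \<noteq> 0" using mn(1) assms(2,3) by auto
  have "(of_int m / of_int n) ^ 2 = (z / w) ^ d" by (simp add: mn(1)[symmetric] d power_mult)
  then have "a * w ^ d * of_int m ^ 2 = a * z ^ d * of_int n ^ 2"
    using assms(2,3) mn(2) by (simp add: field_simps)
  then have "(of_int ((- 1 - B) * m ^ 2) :: rat) = of_int ((1 - B) * n ^ 2)"
    unfolding z w by simp
  then have eq: "(- 1 - B) * m ^ 2 = (1 - B) * n ^ 2" by (simp only: of_int_eq_iff)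
  have "coprime (n ^ 2) (m ^ 2)" using mn(3) by (simp add: coprime_commute)
  moreover have "n ^ 2 dvd (- 1 - B) * m ^ 2" unfolding eq by (rule dvd_triv_right)
  ultimately have "n ^ 2 dvd - 1 - B" using coprime_dvd_mult_left_iff by blast
  then obtain c where c: "- 1 - B = n ^ 2 * c" by blast
  have "n ^ 2 * (1 - B) = (- 1 - B) * m ^ 2" using eq by (simp only: mult.commute)
  also have "\<dots> = n ^ 2 * (m ^ 2 * c)" unfolding c by (simp only: ac_simps)
  finally have "n ^ 2 * (1 - B) = n ^ 2 * (m ^ 2 * c)" .
  then have "1 - B = m ^ 2 * c" using mn(2) by simp
  then have "m ^ 2 * c - n ^ 2 * c = 2" using c by linarith
  then have two: "c * ((m - n) * (m + n)) = 2" by (simp add: algebra_simps power2_eq_square)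
  \<comment> \<open>The factors have equal parity and cannot both be even, as \<open>4\<close> does
    not divide \<open>2\<close>. So both are odd divisors of \<open>2\<close>, which makes
    \<open>m\<close> or \<open>n\<close> zero.\<close>
  have "even (m - n) \<longleftrightarrow> even (m + n)" by simp
  moreover have "\<not> (even (m - n) \<and> even (m + n))"
  proof
    assume "even (m - n) \<and> even (m + n)"
    then have "2 * 2 dvd (m - n) * (m + n)" by (intro mult_dvd_mono) auto
    then have "2 * 2 dvd c * ((m - n) * (m + n))" by (rule dvd_mult)
    then show False using two by simp
  qed
  ultimately have odd: "odd (m - n)" "odd (m + n)" by auto
  have "2 = (m - n) * (c * (m + n))" "2 = (m + n) * (c * (m - n))"
    using two by (simp_all only: ac_simps)
  then have dvd: "m - n dvd 2" "m + n dvd 2" by (blast intro: dvdI)+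
  have unit: "x = 1 \<or> x = - 1" if "odd x" "x dvd 2" for x :: int
  proof -
    have "\<bar>x\<bar> \<le> 2" using dvd_imp_le_int[OF _ that(2)] by simp
    then have "x = - 2 \<or> x = - 1 \<or> x = 0 \<or> x = 1 \<or> x = 2" by linarith
    then show ?thesis using that(1) by auto
  qed
  from unit[OF odd(1) dvd(1)] unit[OF odd(2) dvd(2)] m0 mn(2) show False by linarith
qed

section \<open>The set of small orbits: size, backward invariance, exhaustiveness\<close>

context prime_power_coeff
begin

text \<open>The poles, the nonzero fixed points, and, for even exponent, the points with image
  \<open>-z\<close>; together with \<open>0\<close> and \<open>\<infinity>\<close> these turn out to be all preperiodic points.\<close>

definition small_orbit_coords :: "rat \<Rightarrow> rat set" where
  "small_orbit_coords a = {z. z \<noteq> 0 \<and>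
     (a * z ^ d = - b \<or> a * z ^ d = 1 - b \<or> even d \<and> a * z ^ d = - 1 - b)}"

definition small_orbit_points :: "rat \<Rightarrow> (rat \<times> rat) set set" where
  "small_orbit_points a = {proj_pt 1 0, proj_pt 0 1} \<union> (\<lambda>z. proj_pt z 1) ` small_orbit_coords a"

lemma card_small_orbit_coords:
  assumes a: "a \<noteq> 0"
  shows "finite (small_orbit_coords a) \<and> card (small_orbit_coords a) \<le> 4"
proof -
  define T where "T c = {z. z \<noteq> 0 \<and> a * z ^ d = c}" for c
  have T: "finite (T c)" "card (T c) \<le> 2" for c
    using card_power_fibre[OF a, of d c] d3 by (auto simp: T_def)
  obtain B where B: "b = of_int B" by (rule b_integer)
  \<comment> \<open>Of the fibres over \<open>1 - b\<close> and, for even \<open>d\<close>,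
    \<open>- 1 - b\<close>, at most one is inhabited; \<open>c\<close> selects it.\<close>
  have "\<exists>c. small_orbit_coords a \<subseteq> T (- b) \<union> T c"
  proof (cases "even d \<and> T (- 1 - b) \<noteq> {}")
    case True
    then obtain w where w: "w \<noteq> 0" "a * w ^ d = - 1 - b" by (auto simp: T_def)
    have "a * z ^ d \<noteq> 1 - b" if "z \<noteq> 0" for z
      using no_even_power_ratio[of d z w a B] True w a that by (auto simp: B)
    then have "small_orbit_coords a \<subseteq> T (- b) \<union> T (- 1 - b)"
      by (auto simp: small_orbit_coords_def T_def)
    then show ?thesis by blast
  next
    case False
    then have "small_orbit_coords a \<subseteq> T (- b) \<union> T (1 - b)"
      by (auto simp: small_orbit_coords_def T_def)
    then show ?thesis by blast
  qed
  then obtain c where sub: "small_orbit_coords a \<subseteq> T (- b) \<union> T c" by blast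
  have "card (small_orbit_coords a) \<le> card (T (- b) \<union> T c)" using sub T by (intro card_mono) auto
  also have "\<dots> \<le> card (T (- b)) + card (T c)" by (rule card_Un_le)
  also have "\<dots> \<le> 4" using T[of "- b"] T[of c] by linarith
  finally show ?thesis using finite_subset[OF sub] T by simp
qed

lemma card_small_orbit_points:
  assumes "a \<noteq> 0"
  shows "finite (small_orbit_points a) \<and> card (small_orbit_points a) \<le> 6"
proof -
  let ?f = "\<lambda>z::rat. proj_pt z 1"
  note coords = card_small_orbit_coords[OF assms]
  have "card (small_orbit_points a) \<le> card {proj_pt 1 0, proj_pt 0 (1::rat)} + card (?f ` small_orbit_coords a)"
    unfolding small_orbit_points_def by (rule card_Un_le)
  also have "card (?f ` small_orbit_coords a) \<le> 4"
    using coords card_image_le[of "small_orbit_coords a" ?f] by linarith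
  also have "card {proj_pt 1 0, proj_pt 0 (1::rat)} \<le> 2" by (simp add: card_insert_if)
  finally show ?thesis using coords by (simp add: small_orbit_points_def)
qed

text \<open>An orbit that ever enters the set must have started in it. A nonzero affine preimage of
  \<open>w\<close> is \<open>w * u\<close>, and the preimage equations allow only
  \<open>u = 1\<close> or \<open>u = - 1\<close>.\<close>

lemma small_orbit_points_preimage:
  assumes a: "a \<noteq> 0" and P: "P \<in> P1" and img: "psi d a b P \<in> small_orbit_points a"
  shows "P \<in> small_orbit_points a"
  using P
proof (cases rule: P1_affine_cases)
  case 1
  then show ?thesis by (simp add: small_orbit_points_def)
next
  case (2 z)
  have d2: "d \<ge> 2" using d3 by simp
  define u where "u = a * z ^ d + b"
  show ?thesis
  proof (cases "z = 0 \<or> u = 0")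
    case True
    moreover have "z \<noteq> 0 \<Longrightarrow> u = 0 \<Longrightarrow> z \<in> small_orbit_coords a"
      by (simp add: u_def small_orbit_coords_def eq_neg_iff_add_eq_0)
    ultimately show ?thesis using 2 by (auto simp: small_orbit_points_def)
  next
    case False
    define w where "w = z / u"
    have w0: "w \<noteq> 0" and zw: "z = w * u" using False by (auto simp: w_def)
    have "psi d a b P = proj_pt w 1"
      using psi_affine[OF a b_nonzero d2, of z] False by (simp add: 2 w_def u_def)
    with img w0 have w: "w \<in> small_orbit_coords a"
      by (auto simp: small_orbit_points_def proj_pt_affine_eq_iff proj_pt_affine_neq_infinity)
    have ueq: "u = a * w ^ d * u ^ d + b"
      by (subst (1) u_def) (simp add: zw power_mult_distrib)
    consider "a * w ^ d = - b" | "a * w ^ d = 1 - b" | "even d" "a * w ^ d = - 1 - b"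
      using w by (auto simp: small_orbit_coords_def)
    \<comment> \<open>This suffices: membership of a nonzero \<open>z\<close> depends on
      \<open>z ^ d\<close> alone.\<close>
    then have "z ^ d = w ^ d"
    proof cases
      case 1
      then have "b * u ^ d + u = b" using ueq by simp
      then show ?thesis using no_preimage_of_pole by blast
    next
      case 2
      then have "u = b + (1 - b) * u ^ d" using ueq by simp
      then have "u = 1" by (rule fixed_point_only_preimage)
      then show ?thesis using zw by simp
    next
      case 3
      \<comment> \<open>For even \<open>d\<close>, replacing \<open>u\<close> and \<open>b\<close>
        by their negatives yields the fixed-point equation.\<close>
      interpret neg: prime_power_coeff p e d "- b"
        using prime_p abs_b d3 by unfold_locales auto
      have "u = (- 1 - b) * u ^ d + b" using ueq 3(2) by simp
      then have "- u = - b + (1 - - b) * (- u) ^ d" using 3(1) by (simp add: algebra_simps)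
      then have "- u = 1" by (rule neg.fixed_point_only_preimage)
      then have "z = - w" using zw by (metis minus_minus mult_minus1_right)
      then show ?thesis using 3(1) by simp
    qed
    then have "z \<in> small_orbit_coords a"
      using w False by (simp add: small_orbit_coords_def)
    then show ?thesis using 2 by (simp add: small_orbit_points_def)
  qed
qed

text \<open>By backward invariance an orbit starting outside stays outside, so it avoids
  \<open>0\<close>, infinity and the poles. Finiteness makes it enter a cycle, whose points
  nevertheless lie in the set.\<close>

lemma PrePer_subset_small_orbit_points:
  assumes a: "a \<noteq> 0"
  shows "PrePer (psi d a b) P1 \<subseteq> small_orbit_points a"
proof
  fix P assume "P \<in> PrePer (psi d a b) P1"
  then have P: "P \<in> P1" and fin: "finite {(psi d a b ^^ n) P | n. True}"
    by (auto simp: PrePer_def)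
  have d2: "d \<ge> 2" using d3 by simp
  let ?f = "psi d a b"
  have orbit: "(?f ^^ n) P \<in> P1" for n
    by (induction n) (use P psi_P1[OF a b_nonzero d2] in auto)
  have pull_back: "P \<in> small_orbit_points a" if "(?f ^^ n) P \<in> small_orbit_points a" for n
    using that
    by (induction n) (use small_orbit_points_preimage[OF a orbit] in auto)
  show "P \<in> small_orbit_points a"
  proof (rule ccontr)
    assume "\<not> ?thesis"
    then have out: "(?f ^^ n) P \<notin> small_orbit_points a" for n using pull_back by blast
    have "\<exists>z. (?f ^^ n) P = proj_pt z 1" for n
      using orbit[of n] out[of n] by (cases rule: P1_affine_cases) (auto simp: small_orbit_points_def)
    then obtain z where z: "\<And>n. (?f ^^ n) P = proj_pt (z n) 1" by metis
    have z0: "z n \<noteq> 0" for n using out[of n] z[of n] by (auto simp: small_orbit_points_def)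
    have coords: "z n \<notin> small_orbit_coords a" for n
      using out[of n] z[of n] by (auto simp: small_orbit_points_def)
    have nonpole: "a * z n ^ d + b \<noteq> 0" for n
      using coords[of n] z0[of n] by (simp add: small_orbit_coords_def eq_neg_iff_add_eq_0)
    have step: "z (Suc n) = z n / (a * z n ^ d + b)" for n
    proof -
      have "proj_pt (z (Suc n)) 1 = ?f (proj_pt (z n) 1)" using z[of "Suc n"] z[of n] by simp
      then show ?thesis
        using psi_affine[OF a b_nonzero d2 nonpole] by (simp add: proj_pt_affine_eq_iff)
    qed
    have "{(?f ^^ n) P | n. True} = range (\<lambda>n. (?f ^^ n) P)" by auto
    then have "\<not> inj (\<lambda>n. (?f ^^ n) P)" using fin finite_imageD[of _ "UNIV :: nat set"] by fastforce
    then obtain i j where "i < j" "z i = z j"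
      unfolding inj_def z proj_pt_affine_eq_iff by (metis linorder_neqE_nat)
    have per: "z (i + (n + (j - i))) = z (i + n)" for n
    proof (induction n)
      case 0
      then show ?case using \<open>i < j\<close> \<open>z i = z j\<close> by simp
    next
      case (Suc n)
      then show ?case using step[of "i + (n + (j - i))"] step[of "i + n"] by simp
    qed
    \<comment> \<open>Shifting by the preperiod \<open>i\<close> gives a purely periodic sequence of
      period \<open>j - i\<close>.\<close>
    have "a * z (i + 0) ^ d = 1 - b \<or> even d \<and> a * z (i + 0) ^ d = - 1 - b"
      using \<open>i < j\<close> step z0 nonpole per a
      by (intro periodic_orbit_multiplier[of a "\<lambda>n. z (i + n)" "j - i"]) auto
    then show False using coords[of i] z0[of i] by (simp add: small_orbit_coords_def)
  qed
qed

end

theorem theorem2p9: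
  fixes p d :: nat and a b :: rat
  assumes "prime p" and "d \<ge> 3" and "a \<noteq> 0" and "b \<in> signed_powers p"
  shows "finite (PrePer (psi d a b) P1) \<and> card (PrePer (psi d a b) P1) \<le> 6"
proof -
  \<comment> \<open>The sign of \<open>b\<close> disappears in the absolute value; \<open>p\<close>
    is cast to \<open>int\<close> for the locale.\<close>
  obtain e where "\<bar>b\<bar> = of_int (int p) ^ e"
    using assms(4) by (auto simp: signed_powers_def)
  then interpret prime_power_coeff "int p" e d b
    using assms by unfold_locales auto
  note sub = PrePer_subset_small_orbit_points[OF assms(3)]
  note card = card_small_orbit_points[OF assms(3)]
  show ?thesis
    using finite_subset[OF sub] card_mono[OF _ sub] card by linarith
qed

end
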